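(* Let $m,n\geq 3$ be integers. Then: (i) if $m$ and $n$ are both even, $\chi'_s(C_m\square C_n)\leq 7$; (ii) if $m>3$ is odd and $n$ is even, $\chi'_s(C_m\square C_n)\leq 8$; (iii) if $m=3$ and $n$ is even, $\chi'_s(C_m\square C_n)\leq 9$; (iv) if $m$ and $n$ are both odd, $\chi'_s(C_m\square C_n)\leq 10$.
   Context: $C_n$ is the cycle on $n$ vertices. A star edge coloring of a graph is a proper edge coloring such that no path or cycle with four edges uses at most two colors; $\chi'_s(G)$ is the minimum number of colors in a star edge coloring of $G$. The Cartesian product $G\square H$ has vertex set $V(G)\times V(H)$, with $(a,x)(b,y)$ an edge iff either $ab\in E(G)$ and $x=y$, or $xy\in E(H)$ and $a=b$. *)

theory Defs
  imports Main
begin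

record 'a graph =
  verts :: "'a set"
  edges :: "'a set set"

definition simple_graph :: "'a graph \<Rightarrow> bool" where
  "simple_graph G \<longleftrightarrow> (\<forall>e\<in>edges G. e \<subseteq> verts G \<and> card e = 2)"

text \<open>For \<open>n \<ge> 3\<close> this is the cycle on \<open>n\<close> vertices; smaller \<open>n\<close> give degenerate objects.\<close>

definition cycle_graph :: "nat \<Rightarrow> nat graph" where
  "cycle_graph n = \<lparr>verts = {..<n}, edges = {{i, Suc i mod n} | i. i < n}\<rparr>"

definition cartesian_product :: "'a graph \<Rightarrow> 'b graph \<Rightarrow> ('a \<times> 'b) graph"
    (infixl "\<box>" 70) where
  "G \<box> H = \<lparr>verts = verts G \<times> verts H,
    edges = {{(a, x), (b, y)} | a x b y.
      a \<in> verts G \<and> b \<in> verts G \<and> x \<in> verts H \<and> y \<in> verts H \<and>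
      ({a, b} \<in> edges G \<and> x = y \<or> {x, y} \<in> edges H \<and> a = b)}\<rparr>"

definition walk_edges :: "'a list \<Rightarrow> 'a set list" where
  "walk_edges p = map2 (\<lambda>u v. {u, v}) p (tl p)"

definition is_path :: "'a graph \<Rightarrow> 'a list \<Rightarrow> bool" where
  "is_path G p \<longleftrightarrow> p \<noteq> [] \<and> distinct p \<and> set p \<subseteq> verts G \<and> set (walk_edges p) \<subseteq> edges G"

text \<open>A cycle is given by the list of its vertices, without repeating the first one at the end.\<close>

definition cycle_edges :: "'a list \<Rightarrow> 'a set list" where
  "cycle_edges c = walk_edges (c @ [hd c])"

definition is_cycle :: "'a graph \<Rightarrow> 'a list \<Rightarrow> bool" where
  "is_cycle G c \<longleftrightarrow>
    length c \<ge> 3 \<and> distinct c \<and> set c \<subseteq> verts G \<and> set (cycle_edges c) \<subseteq> edges G"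

definition proper_edge_coloring :: "'a graph \<Rightarrow> ('a set \<Rightarrow> 'c) \<Rightarrow> bool" where
  "proper_edge_coloring G f \<longleftrightarrow>
    (\<forall>e\<in>edges G. \<forall>e'\<in>edges G. e \<noteq> e' \<and> e \<inter> e' \<noteq> {} \<longrightarrow> f e \<noteq> f e')"

definition star_edge_coloring :: "'a graph \<Rightarrow> ('a set \<Rightarrow> 'c) \<Rightarrow> bool" where
  "star_edge_coloring G f \<longleftrightarrow>
    proper_edge_coloring G f \<and>
    \<not> (\<exists>p. is_path G p \<and> length (walk_edges p) = 4 \<and> card (f ` set (walk_edges p)) \<le> 2) \<and>
    \<not> (\<exists>c. is_cycle G c \<and> length (cycle_edges c) = 4 \<and> card (f ` set (cycle_edges c)) \<le> 2)"

definition star_edge_colorable :: "'a graph \<Rightarrow> nat \<Rightarrow> bool" where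
  "star_edge_colorable G k \<longleftrightarrow> (\<exists>f. f ` edges G \<subseteq> {..<k} \<and> star_edge_coloring G f)"

text \<open>
  The minimum is attained whenever \<open>G\<close> has finitely many edges; see
  \<open>star_edge_colorable_card_edges\<close> and \<open>star_edge_colorable_star_chromatic_index\<close> below.
\<close>

definition star_chromatic_index :: "'a graph \<Rightarrow> nat" where
  "star_chromatic_index G = (LEAST k. star_edge_colorable G k)"

lemma star_edge_colorable_card_edges:
  assumes "finite (edges G)"
  shows "star_edge_colorable G (card (edges G))"
proof -
  obtain f :: "'a set \<Rightarrow> nat" where f: "bij_betw f (edges G) {..<card (edges G)}"
    using ex_bij_betw_finite_nat[OF assms] by (auto simp: lessThan_atLeast0)
  have inj: "inj_on f (edges G)" using f by (simp add: bij_betw_def)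
  have P: "card (f ` set (walk_edges p)) > 2"
    if "is_path G p" and l: "length (walk_edges p) = 4" for p
  proof -
    have "length p = Suc (Suc (Suc (Suc (Suc 0))))"
      using l by (cases p) (auto simp: walk_edges_def)
    then obtain a b c d e where p: "p = [a, b, c, d, e]"
      by (auto simp: length_Suc_conv)
    have "card (f ` set (walk_edges p)) = card (set (walk_edges p))"
      using that inj by (auto simp: is_path_def intro!: card_image intro: inj_on_subset)
    also have "\<dots> = 4"
      using that(1) by (auto simp: p is_path_def walk_edges_def doubleton_eq_iff card_insert_if)
    finally show ?thesis by simp
  qed
  have C: "card (f ` set (cycle_edges q)) > 2"
    if "is_cycle G q" and l: "length (cycle_edges q) = 4" for q
  proof -
    have "length q = Suc (Suc (Suc (Suc 0)))"
      using l by (cases q) (auto simp: walk_edges_def cycle_edges_def)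
    then obtain a b c d where q: "q = [a, b, c, d]"
      by (auto simp: length_Suc_conv)
    have "card (f ` set (cycle_edges q)) = card (set (cycle_edges q))"
      using that inj by (auto simp: is_cycle_def intro!: card_image intro: inj_on_subset)
    also have "\<dots> = 4"
      using that(1)
      by (auto simp: q is_cycle_def cycle_edges_def walk_edges_def doubleton_eq_iff card_insert_if)
    finally show ?thesis by simp
  qed
  have "proper_edge_coloring G f"
    using inj by (auto simp: proper_edge_coloring_def dest: inj_onD)
  then have "star_edge_coloring G f"
    using P C by (fastforce simp: star_edge_coloring_def)
  then show ?thesis
    using f by (auto simp: star_edge_colorable_def bij_betw_def)
qed

lemma star_edge_colorable_star_chromatic_index:
  assumes "finite (edges G)"
  shows "star_edge_colorable G (star_chromatic_index G)"
  unfolding star_chromatic_index_def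
  using star_edge_colorable_card_edges[OF assms] by (rule LeastI)

lemma star_chromatic_index_le:
  "star_edge_colorable G k \<Longrightarrow> star_chromatic_index G \<le> k"
  unfolding star_chromatic_index_def by (rule Least_le)

lemma simple_graph_cycle_graph:
  assumes "n \<ge> 3"
  shows "simple_graph (cycle_graph n)"
proof -
  have "i \<noteq> Suc i mod n" if "i < n" for i
    using that assms by (cases "Suc i = n") auto
  then show ?thesis
    using assms by (auto simp: simple_graph_def cycle_graph_def card_2_iff)
qed

lemma simple_graph_cartesian_product:
  assumes "simple_graph G" "simple_graph H"
  shows "simple_graph (G \<box> H)"
proof -
  have "a \<noteq> b" if "{a, b} \<in> edges G" for a b
    using that assms(1) by (auto simp: simple_graph_def card_insert_if split: if_splits)
  moreover have "x \<noteq> y" if "{x, y} \<in> edges H" for x y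
    using that assms(2) by (auto simp: simple_graph_def card_insert_if split: if_splits)
  ultimately show ?thesis
    by (fastforce simp: simple_graph_def cartesian_product_def card_2_iff)
qed

lemma finite_edges_cartesian_product:
  assumes "finite (verts G)" "finite (verts H)"
  shows "finite (edges (G \<box> H))"
proof (rule finite_subset)
  show "edges (G \<box> H) \<subseteq> Pow (verts G \<times> verts H)"
    by (auto simp: cartesian_product_def)
qed (use assms in simp)

end

theory Submission
  imports Defs
begin

text \<open>
  Color the copies of \<open>C\<^sub>m\<close> and the copies of \<open>C\<^sub>n\<close> in \<open>C\<^sub>m \<box> C\<^sub>n\<close> with disjoint sets of colors, the
  latter all in the same way. If on adjacent copies of \<open>C\<^sub>m\<close> equal or incident edges never share a
  color, then the only possible bichromatic paths and cycles with four edges lie inside one copy.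
  So it suffices to find star edge colorings of \<open>C\<^sub>m\<close> that are compatible in this sense along a closed
  walk of length \<open>n\<close>: two colorings if \<open>n\<close> is even (with 4 colors for even \<open>m\<close>, 5 for odd \<open>m > 3\<close>,
  6 for \<open>m = 3\<close>), three colorings with 7 colors for odd \<open>m \<ge> 7\<close>, and a 5-cycle of colorings with
  5 colors for \<open>m = 5\<close>. They arise by concatenating a few short words. The copies of \<open>C\<^sub>n\<close> need 3 more
  colors, or 4 if \<open>n = 5\<close>. Only \<open>C\<^sub>3 \<box> C\<^sub>3\<close> and \<open>C\<^sub>3 \<box> C\<^sub>5\<close> escape this scheme and get explicit colorings.
\<close>

section \<open>Star colorings in terms of walks with four edges\<close>

text \<open>The walk \<open>a b c d e\<close> may be closed, so this condition covers paths and cycles at once.\<close>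

definition walk_star_coloring :: "'a graph \<Rightarrow> ('a set \<Rightarrow> 'c) \<Rightarrow> bool" where
  "walk_star_coloring G f \<longleftrightarrow>
    (\<forall>q x y. {q, x} \<in> edges G \<longrightarrow> {q, y} \<in> edges G \<longrightarrow> x \<noteq> y \<longrightarrow> f {q, x} \<noteq> f {q, y}) \<and>
    (\<forall>a b c d e. {a, b} \<in> edges G \<longrightarrow> {b, c} \<in> edges G \<longrightarrow> {c, d} \<in> edges G \<longrightarrow>
      {d, e} \<in> edges G \<longrightarrow> a \<noteq> c \<longrightarrow> b \<noteq> d \<longrightarrow> c \<noteq> e \<longrightarrow>
      f {a, b} = f {c, d} \<longrightarrow> f {b, c} \<noteq> f {d, e})"

lemma walk_star_coloringI:
  assumes "\<And>q x y. {q, x} \<in> edges G \<Longrightarrow> {q, y} \<in> edges G \<Longrightarrow> x \<noteq> y \<Longrightarrow> f {q, x} \<noteq> f {q, y}"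
    and "\<And>a b c d e. {a, b} \<in> edges G \<Longrightarrow> {b, c} \<in> edges G \<Longrightarrow> {c, d} \<in> edges G \<Longrightarrow>
      {d, e} \<in> edges G \<Longrightarrow> a \<noteq> c \<Longrightarrow> b \<noteq> d \<Longrightarrow> c \<noteq> e \<Longrightarrow>
      f {a, b} = f {c, d} \<Longrightarrow> f {b, c} = f {d, e} \<Longrightarrow> False"
  shows "walk_star_coloring G f"
  unfolding walk_star_coloring_def using assms by blast

lemma walk_star_coloring_proper:
  "walk_star_coloring G f \<Longrightarrow> {q, x} \<in> edges G \<Longrightarrow> {q, y} \<in> edges G \<Longrightarrow> x \<noteq> y \<Longrightarrow> f {q, x} \<noteq> f {q, y}"
  unfolding walk_star_coloring_def by blast

lemma walk_star_coloring_walk: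
  "walk_star_coloring G f \<Longrightarrow> {a, b} \<in> edges G \<Longrightarrow> {b, c} \<in> edges G \<Longrightarrow> {c, d} \<in> edges G \<Longrightarrow>
    {d, e} \<in> edges G \<Longrightarrow> a \<noteq> c \<Longrightarrow> b \<noteq> d \<Longrightarrow> c \<noteq> e \<Longrightarrow>
    f {a, b} = f {c, d} \<Longrightarrow> f {b, c} \<noteq> f {d, e}"
  unfolding walk_star_coloring_def by blast

text \<open>Otherwise \<open>p, q, r\<close> or \<open>q, r, s\<close> are three different
  colors.\<close>

lemma card_le_2_alternating:
  assumes "card {p, q, r, s} \<le> 2" "p \<noteq> q" "q \<noteq> r" "r \<noteq> s"
  shows "p = r \<and> q = s"
proof (rule ccontr)
  assume "\<not> (p = r \<and> q = s)"
  then have "card {p, q, r} = 3 \<or> card {q, r, s} = 3"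
    using assms by auto
  moreover have "card {p, q, r} \<le> card {p, q, r, s}" "card {q, r, s} \<le> card {p, q, r, s}"
    by (auto intro!: card_mono)
  ultimately show False
    using assms(1) by linarith
qed

text \<open>Consecutive edges of a path or cycle have different colors, so if four edges use only
  two colors, these alternate. A cycle is the walk with \<open>e = a\<close>.\<close>

lemma star_edge_coloring_if_walk:
  assumes "simple_graph G" and f: "walk_star_coloring G f"
  shows "star_edge_coloring G f"
proof -
  note proper = walk_star_coloring_proper[OF f] and walk = walk_star_coloring_walk[OF f]
  have "proper_edge_coloring G f"
    unfolding proper_edge_coloring_def
  proof (intro ballI impI)
    fix e e' assume e: "e \<in> edges G" "e' \<in> edges G" "e \<noteq> e' \<and> e \<inter> e' \<noteq> {}"
    then obtain q where q: "q \<in> e" "q \<in> e'"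
      by blast
    have "card e = 2" "card e' = 2"
      using assms(1) e by (auto simp: simple_graph_def)
    then obtain x y where "e = {q, x}" "e' = {q, y}"
      using q by (auto simp: card_2_iff)
    then show "f e \<noteq> f e'"
      using proper[of q x y] e by auto
  qed
  moreover have False if p: "is_path G p" "length (walk_edges p) = 4"
    and c: "card (f ` set (walk_edges p)) \<le> 2" for p
  proof -
    have "length p = Suc (Suc (Suc (Suc (Suc 0))))"
      using p(2) by (cases p) (auto simp: walk_edges_def)
    then obtain a b c d e where [simp]: "p = [a, b, c, d, e]"
      by (auto simp: length_Suc_conv)
    have E: "{a, b} \<in> edges G" "{b, c} \<in> edges G" "{c, d} \<in> edges G" "{d, e} \<in> edges G"
      and D: "a \<noteq> c" "b \<noteq> d" "c \<noteq> e"
      using p(1) by (auto simp: is_path_def walk_edges_def)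
    have "f {a, b} = f {c, d} \<and> f {b, c} = f {d, e}"
    proof (rule card_le_2_alternating)
      show "card {f {a, b}, f {b, c}, f {c, d}, f {d, e}} \<le> 2"
        using c by (simp add: walk_edges_def)
    qed (use proper[of b a c] proper[of c b d] proper[of d c e] E D in \<open>simp_all add: insert_commute\<close>)
    then show False
      using walk E D by blast
  qed
  moreover have False if p: "is_cycle G p" "length (cycle_edges p) = 4"
    and c: "card (f ` set (cycle_edges p)) \<le> 2" for p
  proof -
    have "length p = Suc (Suc (Suc (Suc 0)))"
      using p(2) by (cases p) (auto simp: walk_edges_def cycle_edges_def)
    then obtain a b c d where [simp]: "p = [a, b, c, d]"
      by (auto simp: length_Suc_conv)
    have E: "{a, b} \<in> edges G" "{b, c} \<in> edges G" "{c, d} \<in> edges G" "{d, a} \<in> edges G"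
      and D: "a \<noteq> c" "b \<noteq> d" "c \<noteq> a"
      using p(1) by (auto simp: is_cycle_def cycle_edges_def walk_edges_def)
    have "f {a, b} = f {c, d} \<and> f {b, c} = f {d, a}"
    proof (rule card_le_2_alternating)
      show "card {f {a, b}, f {b, c}, f {c, d}, f {d, a}} \<le> 2"
        using c by (simp add: walk_edges_def cycle_edges_def)
    qed (use proper[of b a c] proper[of c b d] proper[of d c a] E D in \<open>simp_all add: insert_commute\<close>)
    then show False
      using walk E D by blast
  qed
  ultimately show ?thesis
    unfolding star_edge_coloring_def by blast
qed

definition walk_star_colorable :: "'a graph \<Rightarrow> nat \<Rightarrow> bool" where
  "walk_star_colorable G k \<longleftrightarrow> (\<exists>f. f ` edges G \<subseteq> {..<k} \<and> walk_star_coloring G f)"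

lemma walk_star_colorable_mono:
  "walk_star_colorable G k \<Longrightarrow> k \<le> l \<Longrightarrow> walk_star_colorable G l"
  unfolding walk_star_colorable_def by (meson lessThan_subset_iff order_trans)

lemma star_chromatic_index_le_if_walk:
  assumes "simple_graph G" "walk_star_colorable G k"
  shows "star_chromatic_index G \<le> k"
  using assms star_edge_coloring_if_walk
  by (intro star_chromatic_index_le) (auto simp: walk_star_colorable_def star_edge_colorable_def)

section \<open>Edges and colorings of Cartesian products\<close>

lemma edges_cartesian_product_iff:
  assumes "simple_graph G" "simple_graph H"
  shows "{(a, x), (b, y)} \<in> edges (G \<box> H) \<longleftrightarrow>
    {a, b} \<in> edges G \<and> x = y \<and> x \<in> verts H \<or> {x, y} \<in> edges H \<and> a = b \<and> a \<in> verts G"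
    (is "?L \<longleftrightarrow> ?R")
proof
  show ?R if ?L
    using that by (auto simp: cartesian_product_def doubleton_eq_iff insert_commute)
  have "a \<in> verts G \<and> b \<in> verts G" if "{a, b} \<in> edges G"
    using that assms(1) by (auto simp: simple_graph_def)
  moreover have "x \<in> verts H \<and> y \<in> verts H" if "{x, y} \<in> edges H"
    using that assms(2) by (auto simp: simple_graph_def)
  ultimately show ?L if ?R
    using that unfolding cartesian_product_def by (simp; blast)
qed

lemma simple_graph_edgeE:
  assumes "simple_graph G" "e \<in> edges G"
  obtains x y where "e = {x, y}"
proof -
  have "card e = 2"
    using assms by (simp add: simple_graph_def)
  then show thesis
    using that unfolding card_2_iff by auto
qed

text \<open>Allows the assumption \<open>m \<le> n\<close> for odd tori, and lets either factor
  carry the words of columns.\<close>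

lemma walk_star_colorable_swap:
  assumes G: "simple_graph G" and H: "simple_graph H" and "walk_star_colorable (G \<box> H) k"
  shows "walk_star_colorable (H \<box> G) k"
proof -
  obtain f where f: "f ` edges (G \<box> H) \<subseteq> {..<k}" "walk_star_coloring (G \<box> H) f"
    using assms(3) by (auto simp: walk_star_colorable_def)
  define f' where "f' e = f (prod.swap ` e)" for e
  have iff: "{prod.swap p, prod.swap q} \<in> edges (G \<box> H) \<longleftrightarrow> {p, q} \<in> edges (H \<box> G)" for p q
    by (cases p; cases q) (auto simp: edges_cartesian_product_iff G H)
  have f'_eq: "f' {p, q} = f {prod.swap p, prod.swap q}" for p q
    by (simp add: f'_def)
  have "f' e < k" if "e \<in> edges (H \<box> G)" for e
  proof -
    obtain p q where "e = {p, q}"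
      using simple_graph_edgeE simple_graph_cartesian_product[OF H G] \<open>e \<in> _\<close> by metis
    then show ?thesis
      using f(1) that iff[of p q] f'_eq[of p q] by (simp add: image_subset_iff)
  qed
  moreover have "walk_star_coloring (H \<box> G) f'"
  proof (rule walk_star_coloringI)
    fix q x y assume "{q, x} \<in> edges (H \<box> G)" "{q, y} \<in> edges (H \<box> G)" "x \<noteq> y"
    then show "f' {q, x} \<noteq> f' {q, y}"
      using walk_star_coloring_proper[OF f(2), of "prod.swap q" "prod.swap x" "prod.swap y"]
      by (simp add: iff f'_eq inj_eq[OF inj_swap])
  next
    fix a b c d e
    assume "{a, b} \<in> edges (H \<box> G)" "{b, c} \<in> edges (H \<box> G)" "{c, d} \<in> edges (H \<box> G)"
      "{d, e} \<in> edges (H \<box> G)" "a \<noteq> c" "b \<noteq> d" "c \<noteq> e"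
      "f' {a, b} = f' {c, d}" "f' {b, c} = f' {d, e}"
    then show False
      using walk_star_coloring_walk[OF f(2), of "prod.swap a" "prod.swap b" "prod.swap c"
          "prod.swap d" "prod.swap e"] by (simp add: iff f'_eq inj_eq[OF inj_swap])
  qed
  ultimately show ?thesis
    by (auto simp: walk_star_colorable_def)
qed

text \<open>An edge of a product of simple graphs has exactly one singleton projection. It tells the
  direction of the edge and the copy of the factor that contains it.\<close>

definition fiber_coloring :: "('b \<Rightarrow> 'a set \<Rightarrow> 'c) \<Rightarrow> ('a \<Rightarrow> 'b set \<Rightarrow> 'c) \<Rightarrow> ('a \<times> 'b) set \<Rightarrow> 'c" where
  "fiber_coloring f g e =
    (if is_singleton (snd ` e) then f (the_elem (snd ` e)) (fst ` e) else g (the_elem (fst ` e)) (snd ` e))"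

lemma fiber_coloring_simps:
  shows "fiber_coloring f g {(a, x), (b, x)} = f x {a, b}"
    and "x \<noteq> y \<Longrightarrow> fiber_coloring f g {(a, x), (a, y)} = g a {x, y}"
proof -
  show "fiber_coloring f g {(a, x), (b, x)} = f x {a, b}"
    by (simp add: fiber_coloring_def)
  have "\<not> is_singleton {x, y}" if "x \<noteq> y"
    using that by (metis insertCI is_singleton_the_elem singletonD)
  then show "fiber_coloring f g {(a, x), (a, y)} = g a {x, y}" if "x \<noteq> y"
    using that by (simp add: fiber_coloring_def)
qed

text \<open>The colors below \<open>k\<close> are reserved for the copies of \<open>G\<close>, so
  edges of equal color have the same direction. If the colors of a walk alternate, its directions
  are therefore constant or alternate as well. In the first case the walk stays in one copy of a
  factor. In the second, two edges of equal color lie on adjacent copies of \<open>G\<close> and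
  their projections to \<open>G\<close> share a vertex, which \<open>compat\<close> excludes; its
  instance \<open>c = a\<close> covers equal projections.\<close>

lemma walk_star_colorable_cartesian_product:
  fixes f :: "'b \<Rightarrow> 'a set \<Rightarrow> nat" and g :: "'b set \<Rightarrow> nat"
  assumes G: "simple_graph G" and H: "simple_graph H"
    and f: "\<And>x. x \<in> verts H \<Longrightarrow> f x ` edges G \<subseteq> {..<k} \<and> walk_star_coloring G (f x)"
    and compat: "\<And>x y a b c. {x, y} \<in> edges H \<Longrightarrow> {a, b} \<in> edges G \<Longrightarrow> {b, c} \<in> edges G \<Longrightarrow>
      f x {a, b} \<noteq> f y {b, c}"
    and g: "walk_star_colorable H l"
  shows "walk_star_colorable (G \<box> H) (k + l)"
proof -
  obtain g where g: "g ` edges H \<subseteq> {..<l}" "walk_star_coloring H g"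
    using assms(5) by (auto simp: walk_star_colorable_def)
  define F where "F = fiber_coloring f (\<lambda>_ e. k + g e)"
  note iff = edges_cartesian_product_iff[OF G H]
  have neH: "x \<noteq> y" if "{x, y} \<in> edges H" for x y
    using that H by (auto simp: simple_graph_def)
  have fiber: "{a, b} \<in> edges G \<and> x = y \<and> x \<in> verts H \<and> F {(a, x), (b, y)} = f x {a, b} \<and>
        F {(a, x), (b, y)} < k \<or>
      {x, y} \<in> edges H \<and> a = b \<and> F {(a, x), (b, y)} = k + g {x, y} \<and> F {(a, x), (b, y)} < k + l"
    if E: "{(a, x), (b, y)} \<in> edges (G \<box> H)" for a x b y
  proof -
    consider "{a, b} \<in> edges G" "x = y" "x \<in> verts H" | "{x, y} \<in> edges H" "a = b"
      using E by (auto simp: iff)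
    then show ?thesis
    proof cases
      case 1
      then show ?thesis
        using f[of x] by (auto simp: F_def fiber_coloring_simps)
    next
      case 2
      then show ?thesis
        using neH[of x y] g(1) by (auto simp: F_def fiber_coloring_simps)
    qed
  qed
  have horizontal: "{a, b} \<in> edges G \<and> x = y \<and> x \<in> verts H \<and> F {(a, x), (b, y)} = f x {a, b}"
    if "{(a, x), (b, y)} \<in> edges (G \<box> H)" "F {(a, x), (b, y)} < k" for a x b y
    using fiber[OF that(1)] that(2) by linarith
  have vertical: "{x, y} \<in> edges H \<and> a = b \<and> F {(a, x), (b, y)} = k + g {x, y}"
    if "{(a, x), (b, y)} \<in> edges (G \<box> H)" "\<not> F {(a, x), (b, y)} < k" for a x b y
    using fiber[OF that(1)] that(2) by linarith
  show ?thesis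
    unfolding walk_star_colorable_def
  proof (intro exI conjI)
    show "F ` edges (G \<box> H) \<subseteq> {..<k + l}"
    proof safe
      fix e assume e: "e \<in> edges (G \<box> H)"
      then obtain a x b y where "e = {(a, x), (b, y)}"
        by (auto simp: cartesian_product_def)
      then show "F e < k + l"
        using fiber[of a x b y] e by auto
    qed
  next
    show "walk_star_coloring (G \<box> H) F"
    proof (rule walk_star_coloringI)
      fix p q r assume E: "{p, q} \<in> edges (G \<box> H)" "{p, r} \<in> edges (G \<box> H)" "q \<noteq> r"
      obtain a x b y c z where [simp]: "p = (a, x)" "q = (b, y)" "r = (c, z)"
        by (cases p; cases q; cases r)
      show "F {p, q} \<noteq> F {p, r}"
      proof
        assume F: "F {p, q} = F {p, r}"
        show False
        proof (cases "F {p, q} < k")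
          case True
          then show False
            using horizontal[of a x b y] horizontal[of a x c z] E F
              walk_star_coloring_proper[of G "f x" a b c] f[of x] by auto
        next
          case False
          then show False
            using vertical[of a x b y] vertical[of a x c z] E F
              walk_star_coloring_proper[OF g(2), of x y z] by auto
        qed
      qed
    next
      fix p q r s t :: "'a \<times> 'b"
      assume E: "{p, q} \<in> edges (G \<box> H)" "{q, r} \<in> edges (G \<box> H)" "{r, s} \<in> edges (G \<box> H)"
        "{s, t} \<in> edges (G \<box> H)" and D: "p \<noteq> r" "q \<noteq> s" "r \<noteq> t"
        and F: "F {p, q} = F {r, s}" "F {q, r} = F {s, t}"
      obtain a x b y c z d u e v where
        [simp]: "p = (a, x)" "q = (b, y)" "r = (c, z)" "s = (d, u)" "t = (e, v)"
        by (cases p; cases q; cases r; cases s; cases t)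
      show False
      proof (cases "F {p, q} < k")
        case True
        then have 1: "{a, b} \<in> edges G" "x = y" "x \<in> verts H" "F {p, q} = f x {a, b}"
          "{c, d} \<in> edges G" "z = u" "z \<in> verts H" "F {r, s} = f z {c, d}"
          using horizontal[of a x b y] horizontal[of c z d u] E F by auto
        show False
        proof (cases "F {q, r} < k")
          case True
          then have "{b, c} \<in> edges G" "y = z" "F {q, r} = f y {b, c}"
            "{d, e} \<in> edges G" "u = v" "F {s, t} = f u {d, e}"
            using horizontal[of b y c z] horizontal[of d u e v] E F by auto
          then show False
            using walk_star_coloring_walk[of G "f x" a b c d e] f[of x] 1 D F by auto
        next
          case False
          then have "{y, z} \<in> edges H" "b = c"
            using vertical[of b y c z] E by auto
          then show False
            using compat[of y z a b d] 1 F by auto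
        qed
      next
        case False
        then have 1: "{x, y} \<in> edges H" "a = b" "F {p, q} = k + g {x, y}"
          "{z, u} \<in> edges H" "c = d" "F {r, s} = k + g {z, u}"
          using vertical[of a x b y] vertical[of c z d u] E F by auto
        show False
        proof (cases "F {q, r} < k")
          case True
          then have "{b, c} \<in> edges G" "y = z" "F {q, r} = f y {b, c}"
            "{d, e} \<in> edges G" "u = v" "F {s, t} = f u {d, e}"
            using horizontal[of b y c z] horizontal[of d u e v] E F by auto
          then show False
            using compat[of z u b c e] 1 F by auto
        next
          case False
          then have "{y, z} \<in> edges H" "b = c" "F {q, r} = k + g {y, z}"
            "{u, v} \<in> edges H" "d = e" "F {s, t} = k + g {u, v}"
            using vertical[of b y c z] vertical[of d u e v] E F by auto
          then show False
            using walk_star_coloring_walk[OF g(2), of x y z u v] 1 D F by auto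
        qed
      qed
    qed
  qed
qed

section \<open>Colorings of a cycle as cyclic words\<close>

text \<open>For \<open>m \<ge> 3\<close> each edge of the cycle has a unique such \<open>i\<close>,
  so a word of \<open>m\<close> colors amounts to an edge coloring.\<close>

definition cycle_pos :: "nat \<Rightarrow> nat set \<Rightarrow> nat" where
  "cycle_pos m e = (THE i. i < m \<and> e = {i, Suc i mod m})"

lemma Suc_mod_eq: "i < m \<Longrightarrow> Suc i mod m = (if Suc i = m then 0 else Suc i)"
  by auto

lemma Suc_mod_inject: "i < m \<Longrightarrow> j < m \<Longrightarrow> Suc i mod m = Suc j mod m \<Longrightarrow> i = j"
  by (auto simp: Suc_mod_eq split: if_splits)

lemma cycle_pos_eq [simp]:
  assumes "m \<ge> 3" "i < m"
  shows "cycle_pos m {i, Suc i mod m} = i" "cycle_pos m {Suc i mod m, i} = i"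
proof -
  show "cycle_pos m {i, Suc i mod m} = i"
    unfolding cycle_pos_def using assms
    by (intro the_equality) (auto simp: doubleton_eq_iff Suc_mod_eq split: if_splits)
  then show "cycle_pos m {Suc i mod m, i} = i"
    by (simp add: insert_commute)
qed

lemma verts_cycle_graph: "verts (cycle_graph m) = {..<m}"
  by (simp add: cycle_graph_def)

lemma edges_cycle_graph_iff:
  assumes "m \<ge> 3"
  shows "{a, b} \<in> edges (cycle_graph m) \<longleftrightarrow> a < m \<and> b < m \<and> (b = Suc a mod m \<or> a = Suc b mod m)"
  using assms by (auto simp: cycle_graph_def doubleton_eq_iff)

text \<open>A walk that never turns back runs around the cycle in one direction, so only four
  cyclically consecutive letters matter.\<close>

lemma walk_star_coloring_cycle:
  assumes m: "m \<ge> 3"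
    and proper: "\<And>i. i < m \<Longrightarrow> h i \<noteq> h (Suc i mod m)"
    and star: "\<And>i. i < m \<Longrightarrow> h i = h ((i + 2) mod m) \<Longrightarrow> h (Suc i mod m) \<noteq> h ((i + 3) mod m)"
  shows "walk_star_coloring (cycle_graph m) (\<lambda>e. h (cycle_pos m e))"
proof (rule walk_star_coloringI)
  fix q x y assume "{q, x} \<in> edges (cycle_graph m)" "{q, y} \<in> edges (cycle_graph m)" "x \<noteq> y"
  then show "h (cycle_pos m {q, x}) \<noteq> h (cycle_pos m {q, y})"
    using m Suc_mod_inject proper by (auto simp: edges_cycle_graph_iff) metis+
next
  have mod2: "Suc (Suc i mod m) mod m = (i + 2) mod m"
    and mod3: "Suc ((i + 2) mod m) mod m = (i + 3) mod m" for i
    by (simp_all add: mod_Suc_eq numeral_3_eq_3)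
  have forward: False if "i < m" "h i = h (Suc (Suc i mod m) mod m)"
    "h (Suc i mod m) = h (Suc (Suc (Suc i mod m) mod m) mod m)" for i
    using star[of i] that unfolding mod2 mod3 by blast
  fix a b c d e
  assume E: "{a, b} \<in> edges (cycle_graph m)" "{b, c} \<in> edges (cycle_graph m)"
    "{c, d} \<in> edges (cycle_graph m)" "{d, e} \<in> edges (cycle_graph m)"
    and D: "a \<noteq> c" "b \<noteq> d" "c \<noteq> e"
    and h: "h (cycle_pos m {a, b}) = h (cycle_pos m {c, d})"
      "h (cycle_pos m {b, c}) = h (cycle_pos m {d, e})"
  have lt: "a < m" "b < m" "c < m" "d < m" "e < m"
    using E m by (auto simp: edges_cycle_graph_iff)
  show False
  proof (cases "b = Suc a mod m")
    case True
    then have "c = Suc b mod m"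
      using E(2) D lt m Suc_mod_inject by (auto simp: edges_cycle_graph_iff)
    moreover from this have "d = Suc c mod m"
      using E(3) D lt m Suc_mod_inject by (auto simp: edges_cycle_graph_iff)
    moreover from this have "e = Suc d mod m"
      using E(4) D lt m Suc_mod_inject by (auto simp: edges_cycle_graph_iff)
    ultimately show False
      using forward[of a] h lt m True by simp
  next
    \<comment> \<open>The walk runs backwards; it is read from its end \<open>e\<close>.\<close>
    case False
    then have b: "a = Suc b mod m"
      using E(1) m by (auto simp: edges_cycle_graph_iff)
    then have c: "b = Suc c mod m"
      using E(2) D m by (auto simp: edges_cycle_graph_iff)
    then have d: "c = Suc d mod m"
      using E(3) D m by (auto simp: edges_cycle_graph_iff)
    then have e: "d = Suc e mod m"
      using E(4) D m by (auto simp: edges_cycle_graph_iff)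
    have "cycle_pos m {a, b} = b" "cycle_pos m {b, c} = c" "cycle_pos m {c, d} = d"
      "cycle_pos m {d, e} = e"
      using b c d e lt m by simp_all
    then show False
      using forward[of e] h lt b c d e by metis
  qed
qed

section \<open>Concatenation of cyclic words\<close>

definition cyclic_windows :: "('a \<Rightarrow> 'a \<Rightarrow> 'a \<Rightarrow> 'a \<Rightarrow> bool) \<Rightarrow> 'a list \<Rightarrow> bool" where
  "cyclic_windows R w \<longleftrightarrow> (\<forall>i<length w.
    R (w ! i) (w ! (Suc i mod length w)) (w ! ((i + 2) mod length w)) (w ! ((i + 3) mod length w)))"

text \<open>A window overshoots the end of its word by at most three letters. There it reads the
  beginning of one of the two words, and the common prefix makes it irrelevant which one.\<close>

lemma nth_append_cyclic:
  assumes "take 3 w = take 3 w'" "3 \<le> length w" "3 \<le> length w'" "d \<le> 3" "i < length w + length w'"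
  shows "(w @ w') ! ((i + d) mod (length w + length w')) =
    (if i < length w then w ! ((i + d) mod length w) else w' ! ((i - length w + d) mod length w'))"
proof -
  have eq: "w ! j = w' ! j" if "j < 3" for j
    using assms(1) that by (metis nth_take)
  show ?thesis
  proof (cases "i < length w")
    case True
    then show ?thesis
    proof (cases "i + d < length w")
      case False
      then have "(i + d) mod length w = i + d - length w" "i + d - length w < 3"
        using assms True by (auto simp: mod_if)
      then show ?thesis
        using True False assms eq[of "i + d - length w"] by (auto simp: nth_append)
    qed (simp add: nth_append)
  next
    case False
    then show ?thesis
    proof (cases "i + d < length w + length w'")
      case True
      then show ?thesis
        using False by (auto simp: nth_append not_less)
    next
      case False': False
      then have "(i + d) mod (length w + length w') = i + d - (length w + length w')"
        "(i - length w + d) mod length w' = i + d - (length w + length w')"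
        "i + d - (length w + length w') < 3"
        using assms False by (auto simp: mod_if)
      then show ?thesis
        using False assms eq[of "i + d - (length w + length w')"] by (auto simp: nth_append)
    qed
  qed
qed

lemma cyclic_windows_append:
  assumes "take 3 w = take 3 w'" "3 \<le> length w" "3 \<le> length w'"
    and "cyclic_windows R w" "cyclic_windows R w'"
  shows "cyclic_windows R (w @ w')"
  unfolding cyclic_windows_def length_append
proof (intro allI impI)
  fix i assume i: "i < length w + length w'"
  note nth = nth_append_cyclic[OF assms(1-3) _ i]
  show "R ((w @ w') ! i) ((w @ w') ! (Suc i mod (length w + length w')))
    ((w @ w') ! ((i + 2) mod (length w + length w'))) ((w @ w') ! ((i + 3) mod (length w + length w')))"
  proof (cases "i < length w")
    case True
    then show ?thesis
      using assms(4) nth[of 0] nth[of 1] nth[of 2] nth[of 3] i unfolding cyclic_windows_def by simp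
  next
    case False
    have "i - length w < length w'"
      using False i by linarith
    then have "R (w' ! (i - length w)) (w' ! ((i - length w + 1) mod length w'))
        (w' ! ((i - length w + 2) mod length w')) (w' ! ((i - length w + 3) mod length w'))"
      using assms(5) by (simp add: cyclic_windows_def)
    moreover have "(w @ w') ! i = w' ! (i - length w)"
      using False by (simp add: nth_append)
    moreover have "(w @ w') ! (Suc i mod (length w + length w')) = w' ! ((i - length w + 1) mod length w')"
      using nth[of 1] False by simp
    ultimately show ?thesis
      using nth[of 2] nth[of 3] False by simp
  qed
qed

section \<open>Words encoding compatible colorings of a cycle\<close>

text \<open>Entry \<open>t\<close> of a column is the color of one edge in row \<open>t\<close>.
  After properness and the star condition within a row come the conditions between a row and its
  cyclic successor. Their guard fails only for \<open>r = 1\<close>, so words of height 1 encode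
  single colorings.\<close>

definition column_window ::
    "nat \<Rightarrow> nat \<Rightarrow> nat list \<Rightarrow> nat list \<Rightarrow> nat list \<Rightarrow> nat list \<Rightarrow> bool" where
  "column_window r k a b c d \<longleftrightarrow> (\<forall>t<r. a ! t < k \<and> a ! t \<noteq> b ! t \<and>
    (a ! t = c ! t \<longrightarrow> b ! t \<noteq> d ! t) \<and>
    (Suc t mod r \<noteq> t \<longrightarrow> a ! t \<noteq> a ! (Suc t mod r) \<and> a ! t \<noteq> b ! (Suc t mod r) \<and>
      a ! (Suc t mod r) \<noteq> b ! t))"

text \<open>
  A word of \<open>m\<close> columns of height \<open>r\<close> encodes \<open>r\<close> star edge colorings of \<open>C\<^sub>m\<close> such that cyclically
  consecutive ones can be put on adjacent copies of \<open>C\<^sub>m\<close>. Words with the same first three columns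
  can be concatenated.
\<close>

definition column_word :: "nat \<Rightarrow> nat \<Rightarrow> nat list list \<Rightarrow> nat \<Rightarrow> bool" where
  "column_word r k p m \<longleftrightarrow>
    (\<exists>w. length w = m \<and> take 3 w = p \<and> cyclic_windows (column_window r k) w)"

lemma column_wordI:
  "cyclic_windows (column_window r k) w \<Longrightarrow> take 3 w = p \<Longrightarrow> length w = m \<Longrightarrow> column_word r k p m"
  by (auto simp: column_word_def)

lemma column_word_add:
  assumes "length p = 3" "column_word r k p m" "column_word r k p n"
  shows "column_word r k p (m + n)"
proof -
  obtain w w' where w: "length w = m" "take 3 w = p" "cyclic_windows (column_window r k) w"
    "length w' = n" "take 3 w' = p" "cyclic_windows (column_window r k) w'"
    using assms(2,3) by (auto simp: column_word_def)
  then have "3 \<le> length w" "3 \<le> length w'"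
    using assms(1) by (metis length_take min.absorb_iff2)+
  then show ?thesis
    using w cyclic_windows_append[of w w'] unfolding column_word_def
    by (intro exI[of _ "w @ w'"]) auto
qed

text \<open>Every \<open>n \<ge> 3\<close> other than 5 is a sum of threes and fours. Splitting off
  a 3 would lead from 8 to the exceptional 5, hence the separate case \<open>4 + 4\<close>.\<close>

lemma column_word_1_3:
  assumes "n \<ge> 3" "n \<noteq> 5"
  shows "column_word 1 3 [[0], [1], [2]] n"
  using assms
proof (induction n rule: less_induct)
  case (less n)
  have w3: "column_word 1 3 [[0], [1], [2]] 3"
    by (rule column_wordI[of _ _ "[[0], [1], [2]]"]) code_simp+
  have w4: "column_word 1 3 [[0], [1], [2]] 4"
    by (rule column_wordI[of _ _ "[[0], [1], [2], [1]]"]) code_simp+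
  consider "n = 3" | "n = 4" | "n = 4 + 4" | "n \<ge> 6" "n \<noteq> 8"
    using less.prems by linarith
  then show ?case
  proof cases
    case 4
    then have "column_word 1 3 [[0], [1], [2]] (n - 3)"
      by (intro less.IH) auto
    from column_word_add[OF _ w3 this] show ?thesis
      using 4 by simp
  qed (use w3 w4 column_word_add[OF _ w4 w4] in auto)
qed

text \<open>With a word of length 4 available for padding, one further word per residue class modulo
  4 suffices.\<close>

lemma column_word_step4:
  assumes "length p = 3" "column_word r k p 4" "column_word r k p m" "m \<le> n" "4 dvd n - m"
  shows "column_word r k p n"
proof -
  have "column_word r k p (m + 4 * j)" for j
  proof (induction j)
    case (Suc j)
    show ?case
      using column_word_add[OF assms(1) Suc assms(2)] by (simp add: add_ac)
  qed (use assms in simp)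
  then show ?thesis
    using assms(4,5) by (metis dvdE le_add_diff_inverse)
qed

text \<open>The even classes modulo 4 are represented by 4 and 6. Even positions use the colors 0
  and 1, odd positions 2 and 3, and the second row exchanges the colors in each pair; this makes the
  rows compatible.\<close>

lemma column_word_2_4:
  assumes "m \<ge> 4" "even m"
  shows "column_word 2 4 [[0, 1], [2, 3], [0, 1]] m"
proof -
  have w4: "column_word 2 4 [[0, 1], [2, 3], [0, 1]] 4"
    by (rule column_wordI[of _ _ "[[0, 1], [2, 3], [0, 1], [3, 2]]"]) code_simp+
  have w6: "column_word 2 4 [[0, 1], [2, 3], [0, 1]] 6"
    by (rule column_wordI[of _ _ "[[0, 1], [2, 3], [0, 1], [3, 2], [1, 0], [3, 2]]"]) code_simp+
  have "4 \<le> m \<and> 4 dvd m - 4 \<or> 6 \<le> m \<and> 4 dvd m - 6"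
    using assms by presburger
  then show ?thesis
    using column_word_step4[OF _ w4 w4] column_word_step4[OF _ w4 w6] by auto
qed

text \<open>The odd classes modulo 4 are represented by 5 and 7; the word of length 4 serves as
  padding only.\<close>

lemma column_word_2_5:
  assumes "m \<ge> 5" "odd m"
  shows "column_word 2 5 [[0, 1], [2, 3], [0, 4]] m"
proof -
  have w4: "column_word 2 5 [[0, 1], [2, 3], [0, 4]] 4"
    by (rule column_wordI[of _ _ "[[0, 1], [2, 3], [0, 4], [3, 2]]"]) code_simp+
  have w5: "column_word 2 5 [[0, 1], [2, 3], [0, 4]] 5"
    by (rule column_wordI[of _ _ "[[0, 1], [2, 3], [0, 4], [1, 2], [3, 4]]"]) code_simp+
  have w7: "column_word 2 5 [[0, 1], [2, 3], [0, 4]] 7"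
    by (rule column_wordI[of _ _ "[[0, 1], [2, 3], [0, 4], [1, 2], [0, 3], [2, 1], [3, 4]]"])
      code_simp+
  have "5 \<le> m \<and> 4 dvd m - 5 \<or> 7 \<le> m \<and> 4 dvd m - 7"
    using assms by presburger
  then show ?thesis
    using column_word_step4[OF _ w4 w5] column_word_step4[OF _ w4 w7] by auto
qed

text \<open>Three rows in cyclic order are pairwise adjacent, so all pairs of rows are compatible.
  The odd classes modulo 4 are represented by 7 and 9; length 5 is left to
  \<open>column_word_5_5\<close>.\<close>

lemma column_word_3_7:
  assumes "m \<ge> 7" "odd m"
  shows "column_word 3 7 [[0, 1, 2], [3, 4, 5], [0, 1, 6]] m"
proof -
  have w4: "column_word 3 7 [[0, 1, 2], [3, 4, 5], [0, 1, 6]] 4"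
    by (rule column_wordI[of _ _ "[[0, 1, 2], [3, 4, 5], [0, 1, 6], [4, 3, 5]]"]) code_simp+
  have w7: "column_word 3 7 [[0, 1, 2], [3, 4, 5], [0, 1, 6]] 7"
    by (rule column_wordI[of _ _ "[[0, 1, 2], [3, 4, 5], [0, 1, 6], [2, 3, 4], [0, 5, 6],
      [1, 2, 3], [4, 5, 6]]"]) code_simp+
  have w9: "column_word 3 7 [[0, 1, 2], [3, 4, 5], [0, 1, 6]] 9"
    by (rule column_wordI[of _ _ "[[0, 1, 2], [3, 4, 5], [0, 1, 6], [2, 3, 4], [0, 1, 5],
      [3, 2, 4], [0, 5, 6], [1, 2, 3], [4, 6, 5]]"]) code_simp+
  have "7 \<le> m \<and> 4 dvd m - 7 \<or> 9 \<le> m \<and> 4 dvd m - 9"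
    using assms by presburger
  then show ?thesis
    using column_word_step4[OF _ w4 w7] column_word_step4[OF _ w4 w9] by auto
qed

text \<open>The entry in column \<open>i\<close> and row \<open>t\<close> is
  \<open>(i + 2 * t) mod 5\<close>. Each row has five different colors, and the next row at the
  columns \<open>i - 1\<close>, \<open>i\<close>, \<open>i + 1\<close> differs from it by 1, 2, 3
  modulo 5.\<close>

lemma column_word_5_5: "column_word 5 5 [[0, 2, 4, 1, 3], [1, 3, 0, 2, 4], [2, 4, 1, 3, 0]] 5"
  by (rule column_wordI[of _ _ "[[0, 2, 4, 1, 3], [1, 3, 0, 2, 4], [2, 4, 1, 3, 0],
    [3, 0, 2, 4, 1], [4, 1, 3, 0, 2]]"]) code_simp+

section \<open>From words to colorings of tori\<close>

lemma column_word_coloring: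
  assumes m: "m \<ge> 3" and w: "length w = m" "cyclic_windows (column_window r k) w" and t: "t < r"
  shows "walk_star_coloring (cycle_graph m) (\<lambda>e. w ! cycle_pos m e ! t)"
    and "(\<lambda>e. w ! cycle_pos m e ! t) ` edges (cycle_graph m) \<subseteq> {..<k}"
proof -
  have win: "column_window r k (w ! i) (w ! (Suc i mod m)) (w ! ((i + 2) mod m)) (w ! ((i + 3) mod m))"
    if "i < m" for i
    using w that by (auto simp: cyclic_windows_def)
  show "walk_star_coloring (cycle_graph m) (\<lambda>e. w ! cycle_pos m e ! t)"
    by (rule walk_star_coloring_cycle[OF m]) (use win t in \<open>auto simp: column_window_def\<close>)
  show "(\<lambda>e. w ! cycle_pos m e ! t) ` edges (cycle_graph m) \<subseteq> {..<k}"
    using win t m by (auto simp: column_window_def cycle_graph_def)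
qed

text \<open>Equal or incident edges sit in equal or cyclically consecutive columns, and
  \<open>column_window\<close> compares two rows there in both orders.\<close>

lemma column_word_compatible:
  assumes m: "m \<ge> 3" and w: "length w = m" "cyclic_windows (column_window r k) w"
    and t: "t < r" "Suc t mod r \<noteq> t" and E: "{a, b} \<in> edges (cycle_graph m)" "{b, c} \<in> edges (cycle_graph m)"
  shows "w ! cycle_pos m {a, b} ! t \<noteq> w ! cycle_pos m {b, c} ! (Suc t mod r)"
proof -
  have "w ! i ! t \<noteq> w ! i ! (Suc t mod r) \<and> w ! i ! t \<noteq> w ! (Suc i mod m) ! (Suc t mod r) \<and>
      w ! i ! (Suc t mod r) \<noteq> w ! (Suc i mod m) ! t" if "i < m" for i
    using w t that by (auto simp: cyclic_windows_def column_window_def)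
  note col = this
  have lt: "a < m" "b < m" "c < m"
    using E m by (auto simp: edges_cycle_graph_iff)
  consider "b = Suc a mod m" "c = a" | "b = Suc a mod m" "c = Suc b mod m"
    | "a = Suc b mod m" "c = a" | "a = Suc b mod m" "b = Suc c mod m"
    using E m lt Suc_mod_inject by (auto simp: edges_cycle_graph_iff)
  then show ?thesis
  proof cases
    case 1
    then have "cycle_pos m {a, b} = a" "cycle_pos m {b, c} = a"
      using m lt by simp_all
    then show ?thesis
      using col lt by simp
  next
    case 2
    then have "cycle_pos m {a, b} = a" "cycle_pos m {b, c} = b"
      using m lt by simp_all
    then show ?thesis
      using col[of a] lt 2(1) by simp
  next
    case 3
    then have "cycle_pos m {a, b} = b" "cycle_pos m {b, c} = b"
      using m lt by simp_all
    then show ?thesis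
      using col lt by simp
  next
    case 4
    then have "cycle_pos m {a, b} = b" "cycle_pos m {b, c} = c"
      using m lt by simp_all
    then show ?thesis
      using col[of c] lt 4(2) by metis
  qed
qed

lemma walk_star_colorable_cycle:
  assumes "n \<ge> 3"
  shows "walk_star_colorable (cycle_graph n) (if n = 5 then 4 else 3)"
proof (cases "n = 5")
  case True
  \<comment> \<open>The length missing from \<open>column_word_1_3\<close>. Only the color 0 is
    repeated, so no two colors can alternate.\<close>
  have "cyclic_windows (column_window 1 4) [[0], [1], [0], [2], [3]]"
    by code_simp
  from column_word_coloring[OF _ _ this, of 5 0] show ?thesis
    using True by (auto simp: walk_star_colorable_def)
next
  case False
  then obtain w where "length w = n" "cyclic_windows (column_window 1 3) w"
    using column_word_1_3 assms by (auto simp: column_word_def)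
  from column_word_coloring[OF assms this, of 0] show ?thesis
    using False by (auto simp: walk_star_colorable_def)
qed

text \<open>Copy \<open>j\<close> of the first cycle is colored by row \<open>\<tau> j\<close> of
  the word. As \<open>n - r\<close> is even, going back and forth between the last two rows uses up
  the surplus copies and the walk still closes.\<close>

lemma walk_star_colorable_torus:
  assumes m: "m \<ge> 3" and n: "n \<ge> 3" "n \<ge> r" "even (n - r)" and r: "r \<ge> 2"
    and "column_word r k p m" and l: "walk_star_colorable (cycle_graph n) l"
  shows "walk_star_colorable (cycle_graph m \<box> cycle_graph n) (k + l)"
proof -
  obtain w where w: "length w = m" "cyclic_windows (column_window r k) w"
    using assms(6) by (auto simp: column_word_def)
  \<comment> \<open>the walk \<open>0, 1, \<dots>, r - 1, r - 2, r - 1, \<dots>, r - 1\<close> of length \<open>n\<close> on the cycle of the \<open>r\<close> rows\<close>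
  define \<tau> where "\<tau> j = (if j < r then j else if even (j - r) then r - 2 else r - 1)" for j
  have \<tau>_lt: "\<tau> j < r" for j
    using r by (auto simp: \<tau>_def)
  have \<tau>_Suc: "\<tau> (Suc j mod n) = Suc (\<tau> j) mod r \<or> \<tau> j = Suc (\<tau> (Suc j mod n)) mod r" if "j < n" for j
  proof (cases "Suc j = n")
    case True
    \<comment> \<open>By parity the last copy carries the last row, whose cyclic successor is row
      0.\<close>
    then have "\<tau> j = r - 1"
      using n r by (cases "j < r") (auto simp: \<tau>_def)
    then show ?thesis
      using True r by (auto simp: \<tau>_def)
  next
    case False
    consider "Suc j < r" | "Suc j = r" | "r \<le> j"
      by linarith
    then show ?thesis
    proof cases
      case 3
      then have "even (Suc j - r) \<longleftrightarrow> odd (j - r)"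
        by (simp add: Suc_diff_le)
      moreover have "Suc (r - 2) mod r = r - 1"
        using r by simp
      ultimately show ?thesis
        using False that 3 by (auto simp: \<tau>_def)
    qed (use False that r in \<open>auto simp: \<tau>_def\<close>)
  qed
  show ?thesis
  proof (rule walk_star_colorable_cartesian_product[where f = "\<lambda>j e. w ! cycle_pos m e ! \<tau> j"])
    fix x y a b c
    assume H: "{x, y} \<in> edges (cycle_graph n)"
      and G: "{a, b} \<in> edges (cycle_graph m)" "{b, c} \<in> edges (cycle_graph m)"
    have ne: "Suc t mod r \<noteq> t" if "t < r" for t
      using that r by (auto simp: Suc_mod_eq)
    \<comment> \<open>For a step of the walk from a row to its predecessor, the two edges are read
      in reverse order.\<close>
    have G': "{c, b} \<in> edges (cycle_graph m)" "{b, a} \<in> edges (cycle_graph m)"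
      using G by (simp_all add: insert_commute)
    have "\<tau> y = Suc (\<tau> x) mod r \<or> \<tau> x = Suc (\<tau> y) mod r"
      using H \<tau>_Suc n by (auto simp: edges_cycle_graph_iff)
    then show "w ! cycle_pos m {a, b} ! \<tau> x \<noteq> w ! cycle_pos m {b, c} ! \<tau> y"
      using column_word_compatible[OF m w \<tau>_lt ne[OF \<tau>_lt] G]
        column_word_compatible[OF m w \<tau>_lt ne[OF \<tau>_lt] G']
      by (metis insert_commute)
  qed (use column_word_coloring[OF m w \<tau>_lt] simple_graph_cycle_graph m n l in auto)
qed

section \<open>An executable check for explicit colorings of small tori\<close>

text \<open>Lists the four neighbors of a vertex with the colors of the connecting edges. Each edge
  is colored through its start, \<open>h\<close> along the first coordinate and \<open>v\<close>
  along the second. Adding \<open>m - 1\<close> gives the cyclic predecessor without truncated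
  subtraction.\<close>

definition torus_nbs ::
    "nat \<Rightarrow> nat \<Rightarrow> (nat \<Rightarrow> nat \<Rightarrow> nat) \<Rightarrow> (nat \<Rightarrow> nat \<Rightarrow> nat) \<Rightarrow> nat \<times> nat \<Rightarrow> ((nat \<times> nat) \<times> nat) list" where
  "torus_nbs m n h v = (\<lambda>(i, j). let i' = (i + m - 1) mod m; j' = (j + n - 1) mod n in
    [((Suc i mod m, j), h i j), ((i', j), h i' j), ((i, Suc j mod n), v i j), ((i, j'), v i j')])"

text \<open>A walk with four edges is examined from its middle vertex. Two of its neighbors, joined
  to it by edges of colors \<open>c\<close> and \<open>d\<close>, extend to an alternating walk
  exactly if \<open>d\<close> occurs at the first and \<open>c\<close> at the second. The relation
  is symmetric, so \<open>sorted_wrt\<close> covers all pairs.\<close>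

definition torus_check :: "nat \<Rightarrow> nat \<Rightarrow> nat \<Rightarrow> (nat \<Rightarrow> nat \<Rightarrow> nat) \<Rightarrow> (nat \<Rightarrow> nat \<Rightarrow> nat) \<Rightarrow> bool" where
  "torus_check m n k h v \<longleftrightarrow> (\<forall>i<m. \<forall>j<n. h i j < k \<and> v i j < k \<and>
    sorted_wrt (\<lambda>(c, C) (d, D). c \<noteq> d \<and> (d \<in> set C \<longrightarrow> c \<notin> set D))
      (map (\<lambda>(x, c). (c, map snd (torus_nbs m n h v x))) (torus_nbs m n h v (i, j))))"

lemma sorted_wrt_sym:
  "sorted_wrt R xs \<Longrightarrow> symp R \<Longrightarrow> x \<in> set xs \<Longrightarrow> y \<in> set xs \<Longrightarrow> x \<noteq> y \<Longrightarrow> R x y"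
  by (induction xs) (auto dest: sympD)

lemma walk_star_colorable_if_torus_check:
  assumes m: "m \<ge> 3" and n: "n \<ge> 3" and check: "torus_check m n k h v"
  shows "walk_star_colorable (cycle_graph m \<box> cycle_graph n) k"
proof -
  let ?E = "edges (cycle_graph m \<box> cycle_graph n)"
  note simple = simple_graph_cycle_graph[OF m] simple_graph_cycle_graph[OF n]
  define F where "F = fiber_coloring (\<lambda>j e. h (cycle_pos m e) j) (\<lambda>i e. v i (cycle_pos n e))"
  have pred: "(Suc i mod l + l - 1) mod l = i" "Suc i mod l \<noteq> i" if "i < l" "l \<ge> 3" for i l :: nat
    using that by (auto simp: Suc_mod_eq)
  have nbs: "(q, F {p, q}) \<in> set (torus_nbs m n h v p)" and lt: "fst p < m" "snd p < n" if "{p, q} \<in> ?E" for p q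
  proof -
    obtain a x b y where [simp]: "p = (a, x)" "q = (b, y)"
      by (cases p; cases q)
    have *: "{a, b} \<in> edges (cycle_graph m) \<and> x = y \<and> x < n \<or> {x, y} \<in> edges (cycle_graph n) \<and> a = b \<and> a < m"
      using that edges_cartesian_product_iff[OF simple] by (simp add: verts_cycle_graph)
    then show "fst p < m" "snd p < n"
      using m n by (auto simp: edges_cycle_graph_iff)
    consider "a < m" "b = Suc a mod m" "x = y" | "b < m" "a = Suc b mod m" "x = y"
      | "x < n" "y = Suc x mod n" "a = b" | "y < n" "x = Suc y mod n" "a = b"
      using * m n by (auto simp: edges_cycle_graph_iff)
    then show "(q, F {p, q}) \<in> set (torus_nbs m n h v p)"
    proof cases
      case 1
      then have "F {p, q} = h a x"
        using m by (simp add: F_def fiber_coloring_simps)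
      then show ?thesis
        using 1 by (simp add: torus_nbs_def Let_def)
    next
      case 2
      then have "F {p, q} = h b x" and b: "(a + m - 1) mod m = b"
        using m pred(1)[of b m] by (simp_all only: F_def fiber_coloring_simps cycle_pos_eq \<open>p = _\<close> \<open>q = _\<close>)
      then show ?thesis
        using 2(3) unfolding torus_nbs_def Let_def \<open>p = _\<close> \<open>q = _\<close> prod.case b by simp
    next
      case 3
      then have "F {p, q} = v a x"
        using n pred(2)[of x n] by (simp add: F_def fiber_coloring_simps)
      then show ?thesis
        using 3 by (simp add: torus_nbs_def Let_def)
    next
      case 4
      then have "F {p, q} = v a y" and y: "(x + n - 1) mod n = y"
        using n pred(1)[of y n] pred(2)[of y n]
        by (simp_all only: F_def fiber_coloring_simps cycle_pos_eq \<open>p = _\<close> \<open>q = _\<close> not_False_eq_True)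
      then show ?thesis
        using 4(3) unfolding torus_nbs_def Let_def \<open>p = _\<close> \<open>q = _\<close> prod.case y by simp
    qed
  qed
  have nbs': "F {p, q} \<in> snd ` set (torus_nbs m n h v p)" if "{p, q} \<in> ?E" for p q
    using nbs[OF that] by (metis image_eqI snd_conv)
  let ?R = "\<lambda>(x, c) (y, d). c \<noteq> d \<and>
    (d \<in> snd ` set (torus_nbs m n h v x) \<longrightarrow> c \<notin> snd ` set (torus_nbs m n h v y))"
  have check': "F {p, x} \<noteq> F {p, y} \<and>
      (F {p, y} \<in> snd ` set (torus_nbs m n h v x) \<longrightarrow> F {p, x} \<notin> snd ` set (torus_nbs m n h v y))"
    if E: "{p, x} \<in> ?E" "{p, y} \<in> ?E" "x \<noteq> y" for p x y
  proof -
    have "sorted_wrt ?R (torus_nbs m n h v p)"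
      using check lt[OF E(1)] by (cases p) (simp add: torus_check_def sorted_wrt_map case_prod_unfold)
    moreover have "symp ?R"
      by (rule sympI) auto
    ultimately have "?R (x, F {p, x}) (y, F {p, y})"
      by (rule sorted_wrt_sym) (use nbs E in auto)
    then show ?thesis
      by simp
  qed
  have less: "F {p, q} < k" if "{p, q} \<in> ?E" for p q
  proof -
    have "h i j < k" "v i j < k" if "i < m" "j < n" for i j
      using check that by (simp_all add: torus_check_def)
    then have "\<forall>(x, c)\<in>set (torus_nbs m n h v p). c < k"
      using lt[OF that] by (cases p) (simp add: torus_nbs_def Let_def)
    then show ?thesis
      using nbs[OF that] by blast
  qed
  have "F e < k" if "e \<in> ?E" for e
  proof -
    obtain p q where "e = {p, q}"
      using simple_graph_edgeE[OF simple_graph_cartesian_product[OF simple] \<open>e \<in> _\<close>] by blast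
    then show ?thesis
      using less[of p q] that by simp
  qed
  moreover have "walk_star_coloring (cycle_graph m \<box> cycle_graph n) F"
  proof (rule walk_star_coloringI)
    fix a b c d e
    assume "{a, b} \<in> ?E" "{b, c} \<in> ?E" "{c, d} \<in> ?E" "{d, e} \<in> ?E" "b \<noteq> d"
      "F {a, b} = F {c, d}" "F {b, c} = F {d, e}"
    \<comment> \<open>The middle vertex is \<open>c\<close>; the outer edges show the color of
      \<open>{c, d}\<close> at \<open>b\<close> and that of \<open>{b, c}\<close> at
      \<open>d\<close>.\<close>
    then show False
      using check'[of c b d] nbs'[of b a] nbs'[of d e] by (metis insert_commute)
  qed (use check' in blast)
  ultimately show ?thesis
    by (auto simp: walk_star_colorable_def)
qed

text \<open>The color \<open>3 * i + j\<close> stands for the pair \<open>(i, j)\<close> modulo 3.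
  It occurs on just two edges, from \<open>(i, j)\<close> to \<open>(i + 1, j)\<close> and from
  \<open>(i + 2, j + 1)\<close> to \<open>(i + 2, j + 2)\<close>, which have no coordinate in
  common.\<close>

lemma torus_check_3_3:
  "torus_check 3 3 9 (\<lambda>i j. 3 * i + j) (\<lambda>i j. 3 * (Suc i mod 3) + (j + 2) mod 3)"
  by code_simp

text \<open>The tables list \<open>(i + j) mod 5\<close> and \<open>5 + (3 * i + j) mod 5\<close>.\<close>

lemma torus_check_3_5:
  "torus_check 3 5 10 
    (\<lambda>i j. [[0, 1, 2, 3, 4], [1, 2, 3, 4, 0], [2, 3, 4, 0, 1]] ! i ! j)
    (\<lambda>i j. [[5, 6, 7, 8, 9], [8, 9, 5, 6, 7], [6, 7, 8, 9, 5]] ! i ! j)"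
  by code_simp

section \<open>The bounds for all parities\<close>

text \<open>The ten colors are split as 7 + 3 if some factor has length at least 7 and the other is
  not 5, and as 5 + 5 if \<open>m = 5\<close>; the explicit colorings settle the rest.\<close>

lemma walk_star_colorable_odd_torus:
  assumes "odd m" "odd n" "3 \<le> m" "m \<le> n"
  shows "walk_star_colorable (cycle_graph m \<box> cycle_graph n) 10"
proof -
  have n: "n \<ge> 3"
    using assms by simp
  have "m = 3 \<or> m = 5 \<or> m \<ge> 7" "n = 3 \<or> n = 5 \<or> n \<ge> 7"
    using assms n by presburger+
  then consider "m = 3" "n = 3" | "m = 3" "n = 5" | "m = 3" "n \<ge> 7" | "m = 5" "n \<ge> 5" | "m \<ge> 7" "n \<ge> 7"
    using assms by linarith
  then show ?thesis
  proof cases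
    case 1
    then show ?thesis
      using walk_star_colorable_if_torus_check[OF _ _ torus_check_3_3] walk_star_colorable_mono[of _ 9 10]
      by simp
  next
    case 2
    then show ?thesis
      using walk_star_colorable_if_torus_check[OF _ _ torus_check_3_5] by auto
  next
    case 3
    \<comment> \<open>The words need length at least 7, so they run around the longer factor, and
      the triangle indexes their three rows.\<close>
    then have "walk_star_colorable (cycle_graph n \<box> cycle_graph m) (7 + 3)"
      using walk_star_colorable_torus[OF _ _ _ _ _ column_word_3_7, of n m 3]
        walk_star_colorable_cycle[of m] assms by simp
    then show ?thesis
      using walk_star_colorable_swap[of "cycle_graph n" "cycle_graph m"] simple_graph_cycle_graph assms n
      by simp
  next
    case 4
    have "walk_star_colorable (cycle_graph n) 5"
      using walk_star_colorable_mono[OF walk_star_colorable_cycle[OF n], of 5] by simp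
    then show ?thesis
      using walk_star_colorable_torus[OF _ n _ _ _ column_word_5_5, of 5] 4 assms by auto
  next
    case 5
    then show ?thesis
      using walk_star_colorable_torus[OF _ n _ _ _ column_word_3_7, of m 3]
        walk_star_colorable_cycle[OF n] assms by auto
  qed
qed

theorem theorem8:
  fixes m n :: nat
  assumes "m \<ge> 3" and "n \<ge> 3"
  shows "(even m \<and> even n \<longrightarrow> star_chromatic_index (cycle_graph m \<box> cycle_graph n) \<le> 7) \<and>
    (m > 3 \<and> odd m \<and> even n \<longrightarrow> star_chromatic_index (cycle_graph m \<box> cycle_graph n) \<le> 8) \<and>
    (m = 3 \<and> even n \<longrightarrow> star_chromatic_index (cycle_graph m \<box> cycle_graph n) \<le> 9) \<and>
    (odd m \<and> odd n \<longrightarrow> star_chromatic_index (cycle_graph m \<box> cycle_graph n) \<le> 10)"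
proof -
  let ?P = "cycle_graph m \<box> cycle_graph n"
  note simple = simple_graph_cycle_graph[OF assms(1)] simple_graph_cycle_graph[OF assms(2)]
  have index: "star_chromatic_index ?P \<le> k" if "walk_star_colorable ?P k" for k
    using star_chromatic_index_le_if_walk[OF simple_graph_cartesian_product[OF simple] that] by blast
  \<comment> \<open>Two rows alternate along an even cycle. Its length is not 5, so its own edges
    take only three colors.\<close>
  have even_n: "star_chromatic_index ?P \<le> k + 3" if "even n" "column_word 2 k p m" for k p
  proof -
    have "n \<noteq> 5"
      using that(1) by auto
    then show ?thesis
      using walk_star_colorable_torus[OF assms(1,2) _ _ _ that(2)] walk_star_colorable_cycle[OF assms(2)]
        that(1) assms(2) by (intro index) auto
  qed
  have "star_chromatic_index ?P \<le> 7" if "even m" "even n"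
  proof -
    have "m \<ge> 4"
      using that assms(1) by presburger
    then show ?thesis
      using even_n[OF _ column_word_2_4] that by simp
  qed
  moreover have "star_chromatic_index ?P \<le> 8" if "m > 3" "odd m" "even n"
  proof -
    have "m \<ge> 5"
      using that by presburger
    then show ?thesis
      using even_n[OF _ column_word_2_5] that by simp
  qed
  moreover have "star_chromatic_index ?P \<le> 9" if "m = 3" "even n"
  proof -
    \<comment> \<open>Any two edges of a triangle are incident, so compatible rows use disjoint sets
      of three colors.\<close>
    have "column_word 2 6 [[0, 1], [2, 3], [4, 5]] 3"
      by (rule column_wordI[of _ _ "[[0, 1], [2, 3], [4, 5]]"]) code_simp+
    then show ?thesis
      using even_n[of 6] that by simp
  qed
  moreover have "star_chromatic_index ?P \<le> 10" if "odd m" "odd n"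
  proof (cases "m \<le> n")
    case True
    then show ?thesis
      using walk_star_colorable_odd_torus that assms by (intro index) auto
  next
    case False
    then show ?thesis
      using walk_star_colorable_swap[OF simple(2,1)] walk_star_colorable_odd_torus that assms
      by (intro index) auto
  qed
  ultimately show ?thesis
    by blast
qed

end
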